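(* Let $X$ be a finite set with $|X|\ge 2$, and let $\mathcal{S}$ be an inverse submonoid of the symmetric inverse monoid $\operatorname{PSym}(X)$. There exists a graph $\Gamma=(X,E)$ on the vertex set $X$ whose partial automorphism monoid $\operatorname{PAut}(\Gamma)$ is equal to $\mathcal{S}$ if and only if the following four conditions hold: (1) $\mathcal{S}$ is a full inverse submonoid of $\operatorname{PSym}(X)$; (2) for any compatible subset $A\subseteq\mathcal{S}$ of partial permutations of rank $1$, if $\mathcal{S}$ contains the join of any two elements of $A$, then $\mathcal{S}$ contains the join of the set $A$; (3) the rank $2$ elements of $\mathcal{S}$ form at least one and at most two $\mathcal{D}$-classes of $\mathcal{S}$; (4) the $\mathcal{H}$-classes (in $\mathcal{S}$) of the rank $2$ elements of $\mathcal{S}$ are nontrivial (i.e. have more than one element).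
   Context: A graph is a pair $\Gamma=(V,E)$ where $V$ is a finite set and $E$ is a set of $2$-element subsets of $V$ (no loops, no multiple edges). A partial permutation of a finite set $X$ is a bijection $\varphi:Y\to Z$ between subsets $Y,Z\subseteq X$ (possibly empty); $\operatorname{dom}\varphi=Y$, $\operatorname{ran}\varphi=Z$, and its rank is $|Y|=|Z|$. $\operatorname{PSym}(X)$ is the inverse monoid of all partial permutations of $X$ under composition of partial maps ($\psi\varphi$ means $\varphi$ first, then $\psi$, defined wherever this makes sense), with $\varphi^{-1}$ the inverse bijection. An inverse submonoid is a subset containing $\mathrm{id}_X$ and closed under composition and inverses; it is full if it contains all idempotents of $\operatorname{PSym}(X)$, i.e. all $\mathrm{id}_Y$, $Y\subseteq X$. A partial automorphism of a graph $\Gamma=(V,E)$ is an isomorphism between two vertex-induced subgraphs, i.e. a bijection $\varphi:V_1\to V_2$ with $V_1,V_2\subseteq V$ such that for all $u,v\in V_1$, $\{u,v\}\in E$ iff $\{\varphi(u),\varphi(v)\}\in E$ (the empty map is allowed); $\operatorname{PAut}(\Gamma)$ is the inverse submonoid of $\operatorname{PSym}(V)$ of all partial automorphisms. Partial permutations $\varphi,\psi$ are compatible if $\varphi^{-1}\psi$ and $\varphi\psi^{-1}$ are idempotents, equivalently if the union of $\varphi$ and $\psi$ (as relations) is a partial permutation. A set is compatible if its elements are pairwise compatible. The join of a compatible set of partial permutations is the union of its elements, which is its least upper bound in $\operatorname{PSym}(X)$ with respect to the restriction order. Green's relations on a monoid $\mathcal{S}$: $a\mathrel{\mathcal{L}}b$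 iff there are $x,y\in\mathcal{S}$ with $xa=b$, $yb=a$; $a\mathrel{\mathcal{R}}b$ iff there are $x,y\in\mathcal{S}$ with $ax=b$, $by=a$; $\mathcal{H}=\mathcal{L}\cap\mathcal{R}$; $a\mathrel{\mathcal{D}}b$ iff there is $c\in\mathcal{S}$ with $a\mathrel{\mathcal{L}}c\mathrel{\mathcal{R}}b$. *)

theory Defs
  imports "HOL-Algebra.Group"
begin

text \<open>
  A partial permutation is represented by its graph, as a binary relation that is single-valued
  in both directions. Its domain, range and inverse are then \<^const>\<open>Domain\<close>, \<^const>\<open>Range\<close> and
  \<^const>\<open>converse\<close>, its restriction order is inclusion, and the join of a compatible set \<open>A\<close> is \<open>\<Union>A\<close>.
\<close>

definition partial_perm_on :: "'a set \<Rightarrow> ('a \<times> 'a) set \<Rightarrow> bool" where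
  "partial_perm_on X \<phi> \<longleftrightarrow> \<phi> \<subseteq> X \<times> X \<and> single_valued \<phi> \<and> single_valued (converse \<phi>)"

text \<open>
  In the product \<open>\<psi> \<otimes> \<phi>\<close> the factor \<open>\<phi>\<close> is applied first, whereas in the relational
  composition \<open>\<phi> O \<psi>\<close> the first step is the left operand.
\<close>

definition PSym :: "'a set \<Rightarrow> ('a \<times> 'a) set monoid" where
  "PSym X = \<lparr>carrier = {\<phi>. partial_perm_on X \<phi>}, mult = (\<lambda>\<psi> \<phi>. \<phi> O \<psi>), one = Id_on X\<rparr>"

definition rank :: "('a \<times> 'a) set \<Rightarrow> nat" where
  "rank \<phi> = card (Domain \<phi>)"

definition idempotents :: "('m, 'b) monoid_scheme \<Rightarrow> 'm set" where
  "idempotents M = {e \<in> carrier M. e \<otimes>\<^bsub>M\<^esub> e = e}"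

definition inverse_submonoid :: "('a \<times> 'a) set set \<Rightarrow> 'a set \<Rightarrow> bool" where
  "inverse_submonoid S X \<longleftrightarrow> submonoid S (PSym X) \<and> (\<forall>\<phi>\<in>S. converse \<phi> \<in> S)"

definition full_inverse_submonoid :: "('a \<times> 'a) set set \<Rightarrow> 'a set \<Rightarrow> bool" where
  "full_inverse_submonoid S X \<longleftrightarrow> inverse_submonoid S X \<and> idempotents (PSym X) \<subseteq> S"

definition compatible :: "'a set \<Rightarrow> ('a \<times> 'a) set \<Rightarrow> ('a \<times> 'a) set \<Rightarrow> bool" where
  "compatible X \<phi> \<psi> \<longleftrightarrow>
     converse \<phi> \<otimes>\<^bsub>PSym X\<^esub> \<psi> \<in> idempotents (PSym X) \<and>
     \<phi> \<otimes>\<^bsub>PSym X\<^esub> converse \<psi> \<in> idempotents (PSym X)"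

definition compatible_set :: "'a set \<Rightarrow> ('a \<times> 'a) set set \<Rightarrow> bool" where
  "compatible_set X A \<longleftrightarrow> (\<forall>\<phi>\<in>A. \<forall>\<psi>\<in>A. compatible X \<phi> \<psi>)"

definition pjoin :: "('a \<times> 'a) set set \<Rightarrow> ('a \<times> 'a) set" where
  "pjoin A = \<Union>A"

definition green_L :: "('m, 'b) monoid_scheme \<Rightarrow> 'm rel" where
  "green_L M = {(a, b). a \<in> carrier M \<and> b \<in> carrier M \<and>
     (\<exists>x\<in>carrier M. \<exists>y\<in>carrier M. x \<otimes>\<^bsub>M\<^esub> a = b \<and> y \<otimes>\<^bsub>M\<^esub> b = a)}"

definition green_R :: "('m, 'b) monoid_scheme \<Rightarrow> 'm rel" where
  "green_R M = {(a, b). a \<in> carrier M \<and> b \<in> carrier M \<and>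
     (\<exists>x\<in>carrier M. \<exists>y\<in>carrier M. a \<otimes>\<^bsub>M\<^esub> x = b \<and> b \<otimes>\<^bsub>M\<^esub> y = a)}"

definition green_H :: "('m, 'b) monoid_scheme \<Rightarrow> 'm rel" where
  "green_H M = green_L M \<inter> green_R M"

definition green_D :: "('m, 'b) monoid_scheme \<Rightarrow> 'm rel" where
  "green_D M = green_L M O green_R M"

definition simple_graph :: "'a set \<Rightarrow> 'a set set \<Rightarrow> bool" where
  "simple_graph V E \<longleftrightarrow> finite V \<and> (\<forall>e\<in>E. e \<subseteq> V \<and> card e = 2)"

definition PAut :: "'a set \<Rightarrow> 'a set set \<Rightarrow> ('a \<times> 'a) set set" where
  "PAut V E = {\<phi>. partial_perm_on V \<phi> \<and>
     (\<forall>(u, u')\<in>\<phi>. \<forall>(v, v')\<in>\<phi>. {u, v} \<in> E \<longleftrightarrow> {u', v'} \<in> E)}"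

end

theory Submission imports Defs begin

text \<open>
  In an inverse submonoid, \<open>a\<close> and \<open>b\<close> are \<open>\<D>\<close>-related iff some element maps the domain of \<open>a\<close>
  onto the range of \<open>b\<close>. So in the automorphism monoid of a graph, where every bijection between
  two edges, or between two non-edges, is a partial automorphism, the \<open>\<D>\<close>-classes of rank \<open>2\<close>
  are given by the edges and the non-edges. Conversely, take as edges
  the pairs whose identity map lies in one of the \<open>\<D>\<close>-classes of rank \<open>2\<close>. The nontrivial
  \<open>\<H>\<close>-classes provide all transpositions of pairs, hence all maps of rank \<open>1\<close> and all
  bijections between two edges or two non-edges, and condition (2) glues any partial
  automorphism from its restrictions to single points.
\<close>

section \<open>Partial permutations as relations: idempotents, compatible points, rank two\<close>

lemma partial_perm_onD:
  assumes "partial_perm_on X \<phi>" "(x, y) \<in> \<phi>"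
  shows "x \<in> X" "y \<in> X" "(x, z) \<in> \<phi> \<Longrightarrow> z = y" "(z, y) \<in> \<phi> \<Longrightarrow> z = x"
  using assms unfolding partial_perm_on_def single_valued_def by blast+

lemma relcomp_converse_eq_Id_on: "single_valued (converse a) \<Longrightarrow> a O converse a = Id_on (Domain a)"
  unfolding single_valued_def by blast

lemma converse_relcomp_eq_Id_on: "single_valued a \<Longrightarrow> converse a O a = Id_on (Range a)"
  unfolding single_valued_def by blast

lemma Id_on_relcomp: "Id_on A O r = {(x, y) \<in> r. x \<in> A}"
  by blast

lemma relcomp_Id_on: "r O Id_on A = {(x, y) \<in> r. y \<in> A}"
  by blast

text \<open>If \<open>e O e = e\<close>, a pair \<open>(x, y)\<close> of \<open>e\<close> factors
  through some \<open>z\<close>. Single-valuedness forces \<open>z = y\<close> and injectivity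
  forces \<open>z = x\<close>, so \<open>e\<close> fixes every point of its domain.\<close>

lemma idempotents_PSym: "idempotents (PSym X) = Id_on ` Pow X"
proof (intro equalityI subsetI)
  fix e assume "e \<in> idempotents (PSym X)"
  then have p: "partial_perm_on X e" and e: "e O e = e"
    by (simp_all add: idempotents_def PSym_def)
  have "x = y" if xy: "(x, y) \<in> e" for x y
  proof -
    obtain z where z: "(x, z) \<in> e" "(z, y) \<in> e"
      using xy e by blast
    show ?thesis
      using partial_perm_onD[OF p xy] z by metis
  qed
  then have "e = Id_on (Domain e)" by auto
  moreover have "Domain e \<subseteq> X" using p by (auto simp: partial_perm_on_def)
  ultimately show "e \<in> Id_on ` Pow X" by blast
next
  fix e assume "e \<in> Id_on ` Pow X"
  then show "e \<in> idempotents (PSym X)"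
    by (auto simp: idempotents_def PSym_def partial_perm_on_def single_valued_def)
qed

text \<open>Two pairs of a partial permutation agree in both coordinates or in neither, so the
  composites that define compatibility are the identity at one point or empty. This lets the join
  condition be applied to the set of all one-point restrictions of a given map.\<close>

lemma compatible_singletons:
  assumes "partial_perm_on X \<phi>" "(u, u') \<in> \<phi>" "(v, v') \<in> \<phi>"
  shows "compatible X {(u, u')} {(v, v')}"
proof -
  have "u = v \<longleftrightarrow> u' = v'" and X: "u \<in> X" "u' \<in> X"
    using assms partial_perm_onD[OF assms(1)] by metis+
  then consider "u = v" "u' = v'" | "u \<noteq> v" "u' \<noteq> v'" by auto
  \<comment> \<open>These are the two products from \<open>compatible\<close> in relational order,
    where the factor applied first stands on the left.\<close>
  then have "{(v, v')} O {(u', u)} \<in> Id_on ` Pow X \<and> {(v', v)} O {(u, u')} \<in> Id_on ` Pow X"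
  proof cases
    case 1
    then have "{(v, v')} O {(u', u)} = Id_on {u}" "{(v', v)} O {(u, u')} = Id_on {u'}"
      by auto
    with X show ?thesis by blast
  next
    case 2
    then have "{(v, v')} O {(u', u)} = Id_on {}" "{(v', v)} O {(u, u')} = Id_on {}"
      by auto
    then show ?thesis by blast
  qed
  moreover have "converse {p} = {(snd p, fst p)}" for p :: "'a \<times> 'a"
    by (cases p) auto
  ultimately show ?thesis
    unfolding compatible_def idempotents_PSym by (simp add: PSym_def)
qed

text \<open>A map on two points is fixed by its two values, and these exhaust the range, which
  leaves two ways to assign them.\<close>

lemma partial_perm_on_two_point_cases:
  assumes "partial_perm_on X \<phi>" "Domain \<phi> = {u, v}" "Range \<phi> = {u', v'}" "u \<noteq> v"
  shows "\<phi> = {(u, u'), (v, v')} \<or> \<phi> = {(u, v'), (v, u')}"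
proof -
  obtain a b where ab: "(u, a) \<in> \<phi>" "(v, b) \<in> \<phi>"
    using assms(2) by blast
  have eq: "\<phi> = {(u, a), (v, b)}"
  proof (intro equalityI subsetI)
    fix p assume p: "p \<in> \<phi>"
    obtain x y where xy: "p = (x, y)" by (cases p)
    with p assms(2) have "x = u \<or> x = v" by blast
    with p xy ab show "p \<in> {(u, a), (v, b)}"
      using partial_perm_onD(3)[OF assms(1)] by blast
  qed (use ab in auto)
  then have "{a, b} = {u', v'}" using assms(3) by auto
  then show ?thesis using eq by (auto simp: doubleton_eq_iff)
qed

lemma rank_2E:
  assumes "partial_perm_on X \<phi>" "rank \<phi> = 2"
  obtains u v u' v' where "\<phi> = {(u, u'), (v, v')}" "u \<noteq> v" "u' \<noteq> v'"
    "{u, v, u', v'} \<subseteq> X"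
proof -
  obtain u v where D: "Domain \<phi> = {u, v}" "u \<noteq> v"
    using assms(2) by (auto simp: rank_def card_2_iff)
  then obtain u' v' where i: "(u, u') \<in> \<phi>" "(v, v') \<in> \<phi>" by blast
  have "\<phi> = {(u, u'), (v, v')}"
  proof (intro equalityI subsetI)
    fix p assume p: "p \<in> \<phi>"
    obtain x y where xy: "p = (x, y)" by (cases p)
    with p D(1) have "x = u \<or> x = v" by blast
    with p xy i show "p \<in> {(u, u'), (v, v')}"
      using partial_perm_onD(3)[OF assms(1)] by blast
  qed (use i in auto)
  moreover have "u' \<noteq> v'" using i D(2) partial_perm_onD(4)[OF assms(1)] by blast
  moreover have "{u, v, u', v'} \<subseteq> X" using i partial_perm_onD(1,2)[OF assms(1)] by blast
  ultimately show thesis using that D(2) by blast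
qed

section \<open>Green's relations of an inverse submonoid in terms of domains and ranges\<close>

lemma inverse_submonoidD:
  assumes "inverse_submonoid S X"
  shows "\<phi> \<in> S \<Longrightarrow> partial_perm_on X \<phi>"
    and "\<phi> \<in> S \<Longrightarrow> \<psi> \<in> S \<Longrightarrow> \<phi> O \<psi> \<in> S"
    and "\<phi> \<in> S \<Longrightarrow> converse \<phi> \<in> S"
proof -
  have S: "submonoid S (PSym X)" and "\<forall>\<phi>\<in>S. converse \<phi> \<in> S"
    using assms by (auto simp: inverse_submonoid_def)
  then show "\<phi> \<in> S \<Longrightarrow> converse \<phi> \<in> S" by blast
  show "\<phi> \<in> S \<Longrightarrow> partial_perm_on X \<phi>"
    using submonoid.subset[OF S] by (auto simp: PSym_def)
  show "\<phi> \<in> S \<Longrightarrow> \<psi> \<in> S \<Longrightarrow> \<phi> O \<psi> \<in> S"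
    using submonoid.m_closed[OF S, of \<psi> \<phi>] by (simp add: PSym_def)
qed

text \<open>Multiplying on the left means composing afterwards, which cannot enlarge the domain.
  Conversely, when the domains agree, \<open>a\<close> followed by \<open>converse a O b\<close> is
  \<open>b\<close> restricted to the domain of \<open>a\<close>, that is, \<open>b\<close>
  itself.\<close>

lemma green_L_iff:
  assumes "inverse_submonoid S X"
  shows "(a, b) \<in> green_L ((PSym X)\<lparr>carrier := S\<rparr>) \<longleftrightarrow>
    a \<in> S \<and> b \<in> S \<and> Domain a = Domain b"
proof
  assume "(a, b) \<in> green_L ((PSym X)\<lparr>carrier := S\<rparr>)"
  then obtain x y where "a \<in> S" "b \<in> S" and e: "a O x = b" "b O y = a"
    by (auto simp: green_L_def PSym_def)
  moreover have "Domain (a O x) \<subseteq> Domain a" "Domain (b O y) \<subseteq> Domain b" by blast+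
  then have "Domain a = Domain b" using e by simp
  ultimately show "a \<in> S \<and> b \<in> S \<and> Domain a = Domain b" by blast
next
  assume r: "a \<in> S \<and> b \<in> S \<and> Domain a = Domain b"
  have factor: "\<exists>x\<in>S. a O x = b" if "a \<in> S" "b \<in> S" "Domain a = Domain b" for a b
  proof
    show "converse a O b \<in> S" using that inverse_submonoidD[OF assms] by blast
    have "a O (converse a O b) = Id_on (Domain a) O b"
      using inverse_submonoidD(1)[OF assms that(1)]
      by (simp add: O_assoc[symmetric] relcomp_converse_eq_Id_on partial_perm_on_def)
    then show "a O (converse a O b) = b" using that(3) by (auto simp: Id_on_relcomp)
  qed
  show "(a, b) \<in> green_L ((PSym X)\<lparr>carrier := S\<rparr>)"
    using r factor[of a b] factor[of b a] by (simp add: green_L_def PSym_def)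
qed

text \<open>Dual to \<open>green_L_iff\<close>: multiplying on the right means composing beforehand,
  and the multiplier is now \<open>b O converse a\<close>.\<close>

lemma green_R_iff:
  assumes "inverse_submonoid S X"
  shows "(a, b) \<in> green_R ((PSym X)\<lparr>carrier := S\<rparr>) \<longleftrightarrow>
    a \<in> S \<and> b \<in> S \<and> Range a = Range b"
proof
  assume "(a, b) \<in> green_R ((PSym X)\<lparr>carrier := S\<rparr>)"
  then obtain x y where "a \<in> S" "b \<in> S" and e: "x O a = b" "y O b = a"
    by (auto simp: green_R_def PSym_def)
  moreover have "Range (x O a) \<subseteq> Range a" "Range (y O b) \<subseteq> Range b" by blast+
  then have "Range a = Range b" using e by simp
  ultimately show "a \<in> S \<and> b \<in> S \<and> Range a = Range b" by blast
next
  assume r: "a \<in> S \<and> b \<in> S \<and> Range a = Range b"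
  have factor: "\<exists>x\<in>S. x O a = b" if "a \<in> S" "b \<in> S" "Range a = Range b" for a b
  proof
    show "b O converse a \<in> S" using that inverse_submonoidD[OF assms] by blast
    have "(b O converse a) O a = b O Id_on (Range a)"
      using inverse_submonoidD(1)[OF assms that(1)]
      by (simp add: O_assoc converse_relcomp_eq_Id_on partial_perm_on_def)
    then show "(b O converse a) O a = b" using that(3) by (auto simp: relcomp_Id_on)
  qed
  show "(a, b) \<in> green_R ((PSym X)\<lparr>carrier := S\<rparr>)"
    using r factor[of a b] factor[of b a] by (simp add: green_R_def PSym_def)
qed

lemma green_H_iff:
  assumes "inverse_submonoid S X"
  shows "(a, b) \<in> green_H ((PSym X)\<lparr>carrier := S\<rparr>) \<longleftrightarrow>
    a \<in> S \<and> b \<in> S \<and> Domain a = Domain b \<and> Range a = Range b"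
  by (auto simp: green_H_def green_L_iff[OF assms] green_R_iff[OF assms])

lemma green_D_iff:
  assumes "inverse_submonoid S X"
  shows "(a, b) \<in> green_D ((PSym X)\<lparr>carrier := S\<rparr>) \<longleftrightarrow>
    a \<in> S \<and> b \<in> S \<and> (\<exists>c\<in>S. Domain c = Domain a \<and> Range c = Range b)"
proof -
  have "(a, b) \<in> green_D ((PSym X)\<lparr>carrier := S\<rparr>) \<longleftrightarrow>
      (\<exists>c. (a, c) \<in> green_L ((PSym X)\<lparr>carrier := S\<rparr>) \<and> (c, b) \<in> green_R ((PSym X)\<lparr>carrier := S\<rparr>))"
    by (simp add: green_D_def relcomp_unfold)
  also have "\<dots> \<longleftrightarrow>
      (\<exists>c. (a \<in> S \<and> c \<in> S \<and> Domain a = Domain c) \<and> c \<in> S \<and> b \<in> S \<and> Range c = Range b)"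
    by (simp only: green_L_iff[OF assms] green_R_iff[OF assms])
  finally show ?thesis unfolding Bex_def eq_commute[of "Domain a"] by blast
qed

section \<open>From the four conditions to a graph\<close>

lemma full_inverse_submonoid_iff:
  "full_inverse_submonoid S X \<longleftrightarrow> inverse_submonoid S X \<and> (\<forall>Y\<subseteq>X. Id_on Y \<in> S)"
  by (simp add: full_inverse_submonoid_def idempotents_PSym image_subset_iff Pow_def)

text \<open>The H-class of \<open>Id_on {u, v}\<close> consists of the elements of \<open>S\<close>
  with domain and range \<open>{u, v}\<close>. The only candidates are the identity and the
  transposition, so a nontrivial class contains the latter.\<close>

lemma transposition_mem:
  assumes full: "full_inverse_submonoid S X"
    and H: "\<And>\<phi>. \<phi> \<in> S \<Longrightarrow> rank \<phi> = 2 \<Longrightarrow> card (green_H ((PSym X)\<lparr>carrier := S\<rparr>) `` {\<phi>}) > 1"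
    and uv: "u \<in> X" "v \<in> X" "u \<noteq> v"
  shows "{(u, v), (v, u)} \<in> S"
proof -
  have S: "inverse_submonoid S X" and Id: "Id_on {u, v} \<in> S"
    using full uv by (simp_all add: full_inverse_submonoid_iff)
  define \<phi> where "\<phi> = Id_on {u, v}"
  let ?K = "green_H ((PSym X)\<lparr>carrier := S\<rparr>) `` {\<phi>}"
  have "\<phi> \<in> S" using Id by (simp add: \<phi>_def)
  moreover have "rank \<phi> = 2" using uv by (simp add: \<phi>_def rank_def)
  ultimately have "card ?K > 1" using H by blast
  then have "\<not> ?K \<subseteq> {\<phi>}" using card_mono[of "{\<phi>}" ?K] by fastforce
  then obtain \<psi> where \<psi>: "\<psi> \<in> ?K" "\<psi> \<noteq> \<phi>" by blast
  have \<psi>S: "\<psi> \<in> S" and "Domain \<phi> = Domain \<psi>" "Range \<phi> = Range \<psi>"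
    using \<psi>(1) by (simp_all add: green_H_iff[OF S])
  then have "Domain \<psi> = {u, v}" "Range \<psi> = {u, v}"
    by (simp_all add: \<phi>_def)
  then have "\<psi> = {(u, u), (v, v)} \<or> \<psi> = {(u, v), (v, u)}"
    using partial_perm_on_two_point_cases[OF inverse_submonoidD(1)[OF S \<psi>S]] uv(3) by simp
  moreover have "\<phi> = {(u, u), (v, v)}" by (auto simp: \<phi>_def)
  ultimately show ?thesis using \<psi>(2) \<psi>S by (elim disjE) simp_all
qed

text \<open>If \<open>\<theta>\<close> assigns the two values the other way round, precomposing it
  with the transposition corrects the assignment.\<close>

lemma two_point_map_mem:
  assumes S: "inverse_submonoid S X"
    and swap: "{(u, v), (v, u)} \<in> S"
    and uv: "u \<noteq> v" "u' \<noteq> v'"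
    and \<theta>: "\<theta> \<in> S" "Domain \<theta> = {u, v}" "Range \<theta> = {u', v'}"
  shows "{(u, u'), (v, v')} \<in> S"
proof (cases "\<theta> = {(u, u'), (v, v')}")
  case False
  then have "\<theta> = {(u, v'), (v, u')}"
    using partial_perm_on_two_point_cases[OF inverse_submonoidD(1)[OF S \<theta>(1)] \<theta>(2,3) uv(1)]
    by blast
  then have "{(u, v), (v, u)} O \<theta> = {(u, u'), (v, v')}" using uv by auto
  then show ?thesis using inverse_submonoidD(2)[OF S swap \<theta>(1)] by simp
qed (use \<theta> in simp)

text \<open>The class is the image of some \<open>a\<close>, whose domain is mapped onto
  \<open>e\<close> by some \<open>c\<close> and onto \<open>f\<close> by some \<open>d\<close>.
  Going back along \<open>c\<close> and then along \<open>d\<close> leads from \<open>e\<close> to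
  \<open>f\<close>, so transitivity of \<open>green_D\<close> is not invoked.\<close>

lemma Id_on_same_D_class_imp_bijection:
  assumes S: "inverse_submonoid S X"
    and K: "K \<in> S // green_D ((PSym X)\<lparr>carrier := S\<rparr>)"
    and ef: "Id_on e \<in> K" "Id_on f \<in> K"
  shows "\<exists>\<theta>\<in>S. Domain \<theta> = e \<and> Range \<theta> = f"
proof -
  obtain a where "K = green_D ((PSym X)\<lparr>carrier := S\<rparr>) `` {a}"
    using K by (auto simp: quotient_def)
  then obtain c d where c: "c \<in> S" "Domain c = Domain a" "Range c = e"
    and d: "d \<in> S" "Domain d = Domain a" "Range d = f"
    using ef by (auto simp: green_D_iff[OF S])
  have "converse c O d \<in> S" using c d inverse_submonoidD[OF S] by blast
  moreover have "Domain (converse c O d) = e" "Range (converse c O d) = f"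
    using c(2,3) d(2,3) by blast+
  ultimately show ?thesis by blast
qed

text \<open>The element that maps the domain of the representative onto \<open>e\<close> is
  prolonged by \<open>\<theta>\<close> to reach \<open>f\<close>.\<close>

lemma Id_on_mem_D_class:
  assumes S: "inverse_submonoid S X"
    and K: "K \<in> S // green_D ((PSym X)\<lparr>carrier := S\<rparr>)"
    and e: "Id_on e \<in> K"
    and \<theta>: "\<theta> \<in> S" "Domain \<theta> = e" "Range \<theta> = f"
    and f: "Id_on f \<in> S"
  shows "Id_on f \<in> K"
proof -
  obtain a where K: "K = green_D ((PSym X)\<lparr>carrier := S\<rparr>) `` {a}"
    using K by (auto simp: quotient_def)
  then obtain c where a: "a \<in> S" and c: "c \<in> S" "Domain c = Domain a" "Range c = e"
    using e by (auto simp: green_D_iff[OF S])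
  have "c O \<theta> \<in> S" using c \<theta> inverse_submonoidD[OF S] by blast
  moreover have "Domain (c O \<theta>) = Domain a" "Range (c O \<theta>) = f"
    using c(2,3) \<theta>(2,3) by blast+
  ultimately show ?thesis using a f by (auto simp: K green_D_iff[OF S])
qed

lemma exists_graph_with_PAut:
  assumes fin: "finite X" and full: "full_inverse_submonoid S X"
    and join: "\<And>A. A \<subseteq> S \<Longrightarrow> \<forall>\<phi>\<in>A. rank \<phi> = 1 \<Longrightarrow> compatible_set X A \<Longrightarrow>
       \<forall>\<phi>\<in>A. \<forall>\<psi>\<in>A. pjoin {\<phi>, \<psi>} \<in> S \<Longrightarrow> pjoin A \<in> S"
    and C: "C \<subseteq> S // green_D ((PSym X)\<lparr>carrier := S\<rparr>)" "1 \<le> card C" "card C \<le> 2"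
       "\<Union>C = {\<phi> \<in> S. rank \<phi> = 2}"
    and H: "\<And>\<phi>. \<phi> \<in> S \<Longrightarrow> rank \<phi> = 2 \<Longrightarrow>
       card (green_H ((PSym X)\<lparr>carrier := S\<rparr>) `` {\<phi>}) > 1"
  shows "\<exists>E. simple_graph X E \<and> PAut X E = S"
proof -
  have S: "inverse_submonoid S X" using full by (simp add: full_inverse_submonoid_iff)
  have Id: "Id_on Y \<in> S" if "Y \<subseteq> X" for Y
    using full that by (simp add: full_inverse_submonoid_iff)
  have "card C = 1 \<or> card C = 2" using C(2,3) by linarith
  \<comment> \<open>If there is only one class, \<open>K\<close> and \<open>L\<close> coincide; the
    graph defined from \<open>K\<close> is then complete.\<close>
  then have "\<exists>K L. C = {K, L}"
  proof
    assume "card C = 1"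
    then obtain K where "C = {K}" by (rule card_1_singletonE)
    then have "C = {K, K}" by simp
    then show ?thesis by blast
  qed (auto simp: card_2_iff)
  then obtain K L where KL: "C = {K, L}" by blast
  define E where "E = {e. e \<subseteq> X \<and> card e = 2 \<and> Id_on e \<in> K}"
  have K: "K \<in> S // green_D ((PSym X)\<lparr>carrier := S\<rparr>)"
    and L: "L \<in> S // green_D ((PSym X)\<lparr>carrier := S\<rparr>)"
    using C(1) KL by auto
  have cover: "Id_on e \<in> K \<or> Id_on e \<in> L" if "e \<subseteq> X" "card e = 2" for e
  proof -
    have "Id_on e \<in> \<Union>C" unfolding C(4) using Id that by (simp add: rank_def)
    then show ?thesis using KL by auto
  qed
  have swap: "{(u, v), (v, u)} \<in> S" if "u \<in> X" "v \<in> X" "u \<noteq> v" for u v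
    using transposition_mem[OF full H that] by blast
  \<comment> \<open>For distinct points the map arises by restricting the transposition to
    \<open>{u}\<close>.\<close>
  have point: "{(u, v)} \<in> S" if "u \<in> X" "v \<in> X" for u v
  proof (cases "u = v")
    case True
    then show ?thesis using Id[of "{u}"] that by (simp add: Id_on_def)
  next
    case False
    have "Id_on {u} O {(u, v), (v, u)} \<in> S"
      using inverse_submonoidD(2)[OF S Id swap] that False by blast
    moreover have "Id_on {u} O {(u, v), (v, u)} = {(u, v)}" using False by auto
    ultimately show ?thesis by simp
  qed
  \<comment> \<open>The restriction of \<open>\<phi>\<close> to \<open>{u, v}\<close> maps this pair
    onto \<open>{u', v'}\<close> and so carries membership in \<open>K\<close> from one identity to
    the other. The reverse implication comes later by applying this to
    \<open>converse \<phi>\<close>.\<close>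
  have edge_imp: "{u', v'} \<in> E"
    if "\<phi> \<in> S" "(u, u') \<in> \<phi>" "(v, v') \<in> \<phi>" "{u, v} \<in> E" for \<phi> u u' v v'
  proof -
    note pp = inverse_submonoidD(1)[OF S that(1)]
    note X = partial_perm_onD(1,2)[OF pp]
    have uv: "u \<noteq> v" using that(4) by (auto simp: E_def)
    then have uv': "u' \<noteq> v'" using partial_perm_onD(4)[OF pp] that by blast
    have sub: "{u, v} \<subseteq> X" "{u', v'} \<subseteq> X" using X that(2,3) by blast+
    have "Id_on {u, v} O \<phi> \<in> S"
      using inverse_submonoidD(2)[OF S Id[OF sub(1)] that(1)] .
    moreover have "Id_on {u, v} O \<phi> = {(u, u'), (v, v')}"
      using that(2,3) by (auto simp: Id_on_relcomp dest: partial_perm_onD(3)[OF pp])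
    ultimately have "{(u, u'), (v, v')} \<in> S" by simp
    moreover have "Domain {(u, u'), (v, v')} = {u, v}" "Range {(u, u'), (v, v')} = {u', v'}"
      by auto
    moreover have "Id_on {u, v} \<in> K" using that(4) by (simp add: E_def)
    ultimately have "Id_on {u', v'} \<in> K"
      by (intro Id_on_mem_D_class[OF S K _ _ _ _ Id[OF sub(2)]])
    then show ?thesis using sub(2) uv' by (simp add: E_def)
  qed
  have "simple_graph X E" using fin by (auto simp: simple_graph_def E_def)
  moreover have "PAut X E = S"
  proof (intro equalityI subsetI)
    fix \<phi> assume \<phi>: "\<phi> \<in> S"
    have "{u, v} \<in> E \<longleftrightarrow> {u', v'} \<in> E" if "(u, u') \<in> \<phi>" "(v, v') \<in> \<phi>" for u u' v v'
      using edge_imp[OF \<phi> that] edge_imp[OF inverse_submonoidD(3)[OF S \<phi>], of u' u v' v] that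
      by auto
    then show "\<phi> \<in> PAut X E" using inverse_submonoidD(1)[OF S \<phi>] by (auto simp: PAut_def)
  next
    fix \<phi> assume "\<phi> \<in> PAut X E"
    then have pp: "partial_perm_on X \<phi>"
      and edge: "\<And>u u' v v'. (u, u') \<in> \<phi> \<Longrightarrow> (v, v') \<in> \<phi> \<Longrightarrow> {u, v} \<in> E \<longleftrightarrow> {u', v'} \<in> E"
      by (auto simp: PAut_def)
    note X = partial_perm_onD(1,2)[OF pp]
    \<comment> \<open>The join of the one-point restrictions is \<open>\<phi>\<close>. Hence it
      suffices that their pairwise joins, the restrictions of \<open>\<phi>\<close> to at most two
      points, lie in \<open>S\<close>.\<close>
    define A where "A = (\<lambda>p. {p}) ` \<phi>"
    have "pjoin A \<in> S"
    proof (rule join)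
      show "A \<subseteq> S" unfolding A_def using point X by auto
      show "\<forall>\<phi>\<in>A. rank \<phi> = 1" by (auto simp: A_def rank_def)
      show "compatible_set X A"
        unfolding compatible_set_def A_def using compatible_singletons[OF pp] by auto
      have "{(u, u'), (v, v')} \<in> S" if uv: "(u, u') \<in> \<phi>" "(v, v') \<in> \<phi>" for u u' v v'
      proof (cases "u = v")
        case True
        then have "u' = v'" using partial_perm_onD(3)[OF pp] uv by blast
        then show ?thesis using True point X[OF uv(1)] by simp
      next
        case False
        then have ne: "u' \<noteq> v'" using partial_perm_onD(4)[OF pp] uv by blast
        have sub: "{u, v} \<subseteq> X" "{u', v'} \<subseteq> X" using X uv by blast+
        have cards: "card {u, v} = 2" "card {u', v'} = 2" using False ne by simp_all
        have "\<exists>\<theta>\<in>S. Domain \<theta> = {u, v} \<and> Range \<theta> = {u', v'}"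
        proof (cases "{u, v} \<in> E")
          case True
          then have "Id_on {u, v} \<in> K" "Id_on {u', v'} \<in> K"
            using edge[OF uv] unfolding E_def by simp_all
          then show ?thesis by (rule Id_on_same_D_class_imp_bijection[OF S K])
        next
          case False
          \<comment> \<open>Both pairs are non-edges, so their identities lie outside
            \<open>K\<close>, and \<open>cover\<close> places them in \<open>L\<close>.\<close>
          then have "Id_on {u, v} \<in> L" "Id_on {u', v'} \<in> L"
            using edge[OF uv] cover[OF sub(1) cards(1)] cover[OF sub(2) cards(2)] sub cards
            unfolding E_def by simp_all
          then show ?thesis by (rule Id_on_same_D_class_imp_bijection[OF S L])
        qed
        then obtain \<theta> where "\<theta> \<in> S" "Domain \<theta> = {u, v}" "Range \<theta> = {u', v'}" by blast
        then show ?thesis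
          by (intro two_point_map_mem[OF S swap[OF _ _ False] False ne]) (use sub in auto)
      qed
      then show "\<forall>\<phi>\<in>A. \<forall>\<psi>\<in>A. pjoin {\<phi>, \<psi>} \<in> S"
        by (auto simp: A_def pjoin_def insert_commute)
    qed
    moreover have "pjoin A = \<phi>" by (auto simp: A_def pjoin_def)
    ultimately show "\<phi> \<in> S" by simp
  qed
  ultimately show ?thesis by blast
qed

section \<open>From a graph to the four conditions\<close>

lemma pjoin_mem_PAut:
  assumes "\<forall>\<phi>\<in>A. \<forall>\<psi>\<in>A. pjoin {\<phi>, \<psi>} \<in> PAut X E"
  shows "pjoin A \<in> PAut X E"
proof -
  \<comment> \<open>Single-valuedness, injectivity and preservation of edges each involve only two
    pairs at a time, and any two pairs of the join already lie in the union of two members of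
    \<open>A\<close>.\<close>
  have pp: "partial_perm_on X (\<phi> \<union> \<psi>)"
    and edge: "\<And>u u' v v'. (u, u') \<in> \<phi> \<Longrightarrow> (v, v') \<in> \<psi> \<Longrightarrow> {u, v} \<in> E \<longleftrightarrow> {u', v'} \<in> E"
    if "\<phi> \<in> A" "\<psi> \<in> A" for \<phi> \<psi>
  proof -
    have "\<phi> \<union> \<psi> \<in> PAut X E" using assms that by (auto simp: pjoin_def)
    then show "partial_perm_on X (\<phi> \<union> \<psi>)"
      and "\<And>u u' v v'. (u, u') \<in> \<phi> \<Longrightarrow> (v, v') \<in> \<psi> \<Longrightarrow> {u, v} \<in> E \<longleftrightarrow> {u', v'} \<in> E"
      unfolding PAut_def by blast+
  qed
  have "partial_perm_on X (\<Union>A)"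
    unfolding partial_perm_on_def
  proof (intro conjI)
    show "\<Union>A \<subseteq> X \<times> X" using pp unfolding partial_perm_on_def by blast
    show "single_valued (\<Union>A)"
    proof (rule single_valuedI)
      fix x y z assume "(x, y) \<in> \<Union>A" "(x, z) \<in> \<Union>A"
      then obtain \<phi> \<psi> where "\<phi> \<in> A" "\<psi> \<in> A" "(x, y) \<in> \<phi> \<union> \<psi>" "(x, z) \<in> \<phi> \<union> \<psi>" by blast
      then show "y = z" using partial_perm_onD(3)[OF pp] by metis
    qed
    show "single_valued (converse (\<Union>A))"
    proof (rule single_valuedI)
      fix x y z assume "(x, y) \<in> converse (\<Union>A)" "(x, z) \<in> converse (\<Union>A)"
      then obtain \<phi> \<psi> where "\<phi> \<in> A" "\<psi> \<in> A" "(y, x) \<in> \<phi> \<union> \<psi>" "(z, x) \<in> \<phi> \<union> \<psi>" by blast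
      then show "y = z" using partial_perm_onD(4)[OF pp] by metis
    qed
  qed
  moreover have "{u, v} \<in> E \<longleftrightarrow> {u', v'} \<in> E"
    if "(u, u') \<in> \<Union>A" "(v, v') \<in> \<Union>A" for u u' v v'
    using that edge by blast
  ultimately show ?thesis unfolding PAut_def pjoin_def by blast
qed

lemma Id_on_mem_PAut: "Y \<subseteq> X \<Longrightarrow> Id_on Y \<in> PAut X E"
  by (auto simp: PAut_def partial_perm_on_def single_valued_def)

text \<open>Comparing a point with itself asks about a singleton, which is never an edge; the
  remaining comparisons are \<open>edge\<close>, up to the order of the points.\<close>

lemma two_point_map_mem_PAut:
  assumes E: "simple_graph X E" and "{u, v, u', v'} \<subseteq> X" "u \<noteq> v" "u' \<noteq> v'"
    and edge: "{u, v} \<in> E \<longleftrightarrow> {u', v'} \<in> E"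
  shows "{(u, u'), (v, v')} \<in> PAut X E"
proof -
  have "{x} \<notin> E" for x using E by (auto simp: simple_graph_def)
  moreover have "{v, u} = {u, v}" "{v', u'} = {u', v'}" by auto
  moreover have "partial_perm_on X {(u, u'), (v, v')}"
    using assms(2-4) by (auto simp: partial_perm_on_def single_valued_def)
  ultimately show ?thesis using edge by (simp add: PAut_def)
qed

lemma PAut_domain_edge_iff_range_edge:
  assumes "\<phi> \<in> PAut X E" "rank \<phi> = 2"
  shows "Domain \<phi> \<in> E \<longleftrightarrow> Range \<phi> \<in> E"
proof -
  have "partial_perm_on X \<phi>" using assms(1) by (simp add: PAut_def)
  then obtain u v u' v' where \<phi>: "\<phi> = {(u, u'), (v, v')}" using assms(2) by (rule rank_2E)
  then have "{u, v} \<in> E \<longleftrightarrow> {u', v'} \<in> E" using assms(1) by (auto simp: PAut_def)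
  then show ?thesis using \<phi> by simp
qed

lemma green_D_class_PAut:
  assumes E: "simple_graph X E" and S: "inverse_submonoid (PAut X E) X"
    and a: "a \<in> PAut X E" "rank a = 2"
  shows "green_D ((PSym X)\<lparr>carrier := PAut X E\<rparr>) `` {a} =
    {b \<in> PAut X E. rank b = 2 \<and> (Domain a \<in> E \<longleftrightarrow> Domain b \<in> E)}"
proof (intro equalityI subsetI)
  fix b assume "b \<in> green_D ((PSym X)\<lparr>carrier := PAut X E\<rparr>) `` {a}"
  then obtain c where b: "b \<in> PAut X E" and c: "c \<in> PAut X E" "Domain c = Domain a" "Range c = Range b"
    by (auto simp: green_D_iff[OF S])
  have rc: "rank c = 2" using a(2) c(2) by (simp add: rank_def)
  have "partial_perm_on X b" "partial_perm_on X c" using b c(1) by (auto simp: PAut_def)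
  then obtain u v u' v' where c': "c = {(u, u'), (v, v')}" "u' \<noteq> v'" using rc by (auto elim: rank_2E)
  \<comment> \<open>The D-relation controls only the range of \<open>b\<close>. As both projections
    are injective on \<open>b\<close>, its domain has the same size as its range, so
    \<open>b\<close> has rank 2 like \<open>c\<close>.\<close>
  have inj: "inj_on snd b" "inj_on fst b"
    using \<open>partial_perm_on X b\<close> unfolding partial_perm_on_def single_valued_def inj_on_def by auto
  have "card (Domain b) = card (Range b)"
    using card_image[OF inj(1)] card_image[OF inj(2)] by (simp add: Domain_fst Range_snd)
  also have "\<dots> = 2" using c(3) c' by (simp flip: c(3))
  finally have rb: "rank b = 2" by (simp add: rank_def)
  have "Domain a \<in> E \<longleftrightarrow> Domain b \<in> E"
    using PAut_domain_edge_iff_range_edge[OF c(1) rc] PAut_domain_edge_iff_range_edge[OF b rb] c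
    by simp
  with b rb show "b \<in> {b \<in> PAut X E. rank b = 2 \<and> (Domain a \<in> E \<longleftrightarrow> Domain b \<in> E)}" by simp
next
  fix b assume "b \<in> {b \<in> PAut X E. rank b = 2 \<and> (Domain a \<in> E \<longleftrightarrow> Domain b \<in> E)}"
  then have b: "b \<in> PAut X E" "rank b = 2" and ab: "Domain a \<in> E \<longleftrightarrow> Domain b \<in> E" by auto
  obtain u v x y where a': "a = {(u, x), (v, y)}" "u \<noteq> v" "{u, v, x, y} \<subseteq> X"
    using rank_2E[OF inverse_submonoidD(1)[OF S a(1)] a(2)] by metis
  obtain z w u' v' where b': "b = {(z, u'), (w, v')}" "u' \<noteq> v'" "{z, w, u', v'} \<subseteq> X"
    using rank_2E[OF inverse_submonoidD(1)[OF S b(1)] b(2)] by metis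
  \<comment> \<open>The connecting map goes from the domain of \<open>a\<close> to the range of
    \<open>b\<close>, so the edge status has to be moved from the domain of \<open>b\<close> to its
    range.\<close>
  have "{u, v} \<in> E \<longleftrightarrow> {u', v'} \<in> E"
    using ab PAut_domain_edge_iff_range_edge[OF b] a' b' by simp
  then have "{(u, u'), (v, v')} \<in> PAut X E"
    by (intro two_point_map_mem_PAut[OF E]) (use a' b' in simp_all)
  moreover have "Domain {(u, u'), (v, v')} = Domain a" "Range {(u, u'), (v, v')} = Range b"
    using a' b' by auto
  ultimately have "\<exists>c\<in>PAut X E. Domain c = Domain a \<and> Range c = Range b" by blast
  then show "b \<in> green_D ((PSym X)\<lparr>carrier := PAut X E\<rparr>) `` {a}"
    using a b by (simp add: green_D_iff[OF S])
qed

lemma PAut_rank_2_D_classes: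
  assumes "card X \<ge> 2" and E: "simple_graph X E" and S: "inverse_submonoid (PAut X E) X"
  shows "\<exists>C \<subseteq> PAut X E // green_D ((PSym X)\<lparr>carrier := PAut X E\<rparr>).
    1 \<le> card C \<and> card C \<le> 2 \<and> \<Union>C = {\<phi> \<in> PAut X E. rank \<phi> = 2}"
proof (intro exI conjI)
  let ?D = "green_D ((PSym X)\<lparr>carrier := PAut X E\<rparr>)"
  define T where "T = {\<phi> \<in> PAut X E. rank \<phi> = 2}"
  define C where "C = (\<lambda>a. ?D `` {a}) ` T"
  \<comment> \<open>Indexing the candidate classes by a truth value bounds their number by two;
    \<open>K True\<close> belongs to the edges and \<open>K False\<close> to the non-edges.\<close>
  define K where "K P = {b \<in> T. P \<longleftrightarrow> Domain b \<in> E}" for P :: bool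
  have cls: "?D `` {a} = K (Domain a \<in> E)" if "a \<in> T" for a
    using green_D_class_PAut[OF E S] that by (auto simp: T_def K_def)
  have "C \<subseteq> range K" unfolding C_def using cls by (auto simp del: Image_singleton_iff)
  then have "C \<subseteq> {K True, K False}" by (simp add: UNIV_bool insert_commute)
  then have "finite C" and "card C \<le> card {K True, K False}"
    by (auto intro: finite_subset card_mono)
  then show "card C \<le> 2" using card_insert_le_m1[of 2 "{K False}" "K True"] by simp
  \<comment> \<open>Since \<open>X\<close> has at least two points, the identity of a two-point
    subset provides a rank 2 element, hence at least one class.\<close>
  obtain Y where "Y \<subseteq> X" "card Y = 2"
    using assms(1) obtain_subset_with_card_n by metis
  then have "Id_on Y \<in> T" using Id_on_mem_PAut[of Y X E] by (simp add: T_def rank_def)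
  then have "C \<noteq> {}" by (auto simp: C_def)
  then show "1 \<le> card C" using \<open>finite C\<close> by (simp add: Suc_le_eq card_gt_0_iff)
  show "\<Union>C = {\<phi> \<in> PAut X E. rank \<phi> = 2}"
    unfolding T_def[symmetric] C_def using cls by (auto simp: K_def)
  show "C \<subseteq> PAut X E // ?D"
    by (auto simp: C_def T_def quotient_def)
qed

text \<open>Exchanging the two values of \<open>\<phi>\<close> changes neither its domain nor its
  range, and edges are unordered, so the exchanged map is a second partial automorphism in the same
  H-class.\<close>

lemma PAut_rank_2_H_class_nontrivial:
  assumes E: "simple_graph X E" and S: "inverse_submonoid (PAut X E) X"
    and \<phi>: "\<phi> \<in> PAut X E" "rank \<phi> = 2"
  shows "card (green_H ((PSym X)\<lparr>carrier := PAut X E\<rparr>) `` {\<phi>}) > 1"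
proof -
  let ?K = "green_H ((PSym X)\<lparr>carrier := PAut X E\<rparr>) `` {\<phi>}"
  obtain u v u' v' where eq: "\<phi> = {(u, u'), (v, v')}" and uv: "u \<noteq> v" "u' \<noteq> v'"
    and X: "{u, v, u', v'} \<subseteq> X"
    using rank_2E[OF inverse_submonoidD(1)[OF S \<phi>(1)] \<phi>(2)] by metis
  let ?\<psi> = "{(u, v'), (v, u')}"
  have "{u, v} \<in> E \<longleftrightarrow> {v', u'} \<in> E"
    using PAut_domain_edge_iff_range_edge[OF \<phi>] eq by (simp add: insert_commute)
  then have "?\<psi> \<in> PAut X E"
    using two_point_map_mem_PAut[OF E] uv X by (auto simp: insert_commute)
  then have "{\<phi>, ?\<psi>} \<subseteq> ?K"
    using \<phi> eq by (auto simp: green_H_iff[OF S])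
  \<comment> \<open>Finiteness is required because \<open>card\<close> is 0 on infinite
    sets.\<close>
  moreover have "finite ?K"
  proof (rule finite_subset)
    show "?K \<subseteq> Pow (X \<times> X)"
      using inverse_submonoidD(1)[OF S] green_H_iff[OF S]
      unfolding partial_perm_on_def by blast
    show "finite (Pow (X \<times> X))" using E by (simp add: simple_graph_def)
  qed
  moreover have "\<phi> \<noteq> ?\<psi>" using eq uv by (auto simp: doubleton_eq_iff)
  ultimately show ?thesis using card_mono[of ?K "{\<phi>, ?\<psi>}"] by simp
qed

theorem theorem5p1:
  fixes X :: "'a set" and S :: "('a \<times> 'a) set set"
  assumes "finite X" and "card X \<ge> 2" and "inverse_submonoid S X"
  shows "(\<exists>E. simple_graph X E \<and> PAut X E = S) \<longleftrightarrow>
    full_inverse_submonoid S X \<and>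
    (\<forall>A \<subseteq> S. (\<forall>\<phi>\<in>A. rank \<phi> = 1) \<and> compatible_set X A \<and>
       (\<forall>\<phi>\<in>A. \<forall>\<psi>\<in>A. pjoin {\<phi>, \<psi>} \<in> S) \<longrightarrow> pjoin A \<in> S) \<and>
    (\<exists>C \<subseteq> S // green_D ((PSym X)\<lparr>carrier := S\<rparr>). 1 \<le> card C \<and> card C \<le> 2 \<and>
       \<Union>C = {\<phi> \<in> S. rank \<phi> = 2}) \<and>
    (\<forall>\<phi>\<in>S. rank \<phi> = 2 \<longrightarrow> card (green_H ((PSym X)\<lparr>carrier := S\<rparr>) `` {\<phi>}) > 1)"
  (is "?graph \<longleftrightarrow> ?full \<and> ?join \<and> ?D \<and> ?H")
proof
  assume ?graph
  then obtain E where E: "simple_graph X E" and PE: "PAut X E = S" by blast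
  have inv: "inverse_submonoid (PAut X E) X" using assms(3) PE by simp
  have ?full
    using assms(3) Id_on_mem_PAut[of _ X E] PE
    by (simp add: full_inverse_submonoid_iff)
  moreover have ?join using pjoin_mem_PAut[of _ X E] unfolding PE by blast
  moreover have ?D using PAut_rank_2_D_classes[OF assms(2) E inv] unfolding PE .
  moreover have ?H using PAut_rank_2_H_class_nontrivial[OF E inv] unfolding PE by blast
  ultimately show "?full \<and> ?join \<and> ?D \<and> ?H" by blast
next
  assume r: "?full \<and> ?join \<and> ?D \<and> ?H"
  then obtain C where "C \<subseteq> S // green_D ((PSym X)\<lparr>carrier := S\<rparr>)" "1 \<le> card C" "card C \<le> 2"
    "\<Union>C = {\<phi> \<in> S. rank \<phi> = 2}" by blast
  with r show ?graph
    by (intro exists_graph_with_PAut[OF assms(1), of S C]) blast+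
qed

end
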